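(* Let $L$ be a $(p,q)$-leaper with $p+q$ odd and let $C$ be a cycle of $L$ within a $(p+q)\times(p+q)$ chessboard. Then there exists a second leaper $M$, distinct from $L$, such that a Hamiltonian cycle of $M$ exists over the squares of $C$.
   Context: A square is a unit square of the infinite chessboard (the plane dissected into unit squares by two pencils of parallel lines); a board is a set of squares. For nonnegative integers $p,q$, not both zero, a $(p,q)$-leaper is a piece that, from a square $a$, can move to any of the squares $a+(\pm p,\pm q)$, $a+(\pm q,\pm p)$; a $(p,q)$-leaper and a $(q,p)$-leaper are the same leaper, and leapers with different unordered pairs of proportions are distinct. The leaper graph of a leaper $L$ over a board $B$ has the squares of $B$ as vertices, two squares being adjacent when a move of $L$ joins them. A cycle of $L$ within $B$ is a simple cycle in this graph. A Hamiltonian cycle of $M$ over a set of squares $S$ is a Hamiltonian cycle in the leaper graph of $M$ over the board $S$; "the squares of $C$" is the set of squares visited by $C$. *)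

theory Defs
  imports Main "HOL-Library.Product_Plus"
begin

type_synonym square = "int \<times> int"

definition chessboard :: "square \<Rightarrow> nat \<Rightarrow> nat \<Rightarrow> square set" where
  "chessboard a m n = {fst a ..< fst a + int m} \<times> {snd a ..< snd a + int n}"

text \<open>
  A leaper is given by its proportions; the pairs (p, q) and (q, p) describe the same leaper,
  so two leapers are distinct precisely when the sets {p, q} and {r, s} differ.
\<close>

definition leaper :: "nat \<Rightarrow> nat \<Rightarrow> bool" where
  "leaper p q \<longleftrightarrow> \<not> (p = 0 \<and> q = 0)"

definition leaper_move :: "nat \<Rightarrow> nat \<Rightarrow> square \<Rightarrow> square \<Rightarrow> bool" where
  "leaper_move p q a b \<longleftrightarrow>
     (\<exists>s\<in>{1, -1}. \<exists>t\<in>{1, -1}.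
        b = a + (s * int p, t * int q) \<or> b = a + (s * int q, t * int p))"

type_synonym 'v graph = "'v set \<times> 'v set set"

definition leaper_graph :: "nat \<Rightarrow> nat \<Rightarrow> square set \<Rightarrow> square graph" where
  "leaper_graph p q B = (B, {{a, b} | a b. a \<in> B \<and> b \<in> B \<and> leaper_move p q a b})"

text \<open>
  A simple cycle is represented by the list of its vertices in cyclic order, without repeating
  the starting vertex at the end. The bound on the length rules out traversing one edge
  back and forth.
\<close>

definition simple_cycle :: "'v graph \<Rightarrow> 'v list \<Rightarrow> bool" where
  "simple_cycle G c \<longleftrightarrow>
     3 \<le> length c \<and> distinct c \<and> set c \<subseteq> fst G \<and>
     (\<forall>i < length c. {c ! i, c ! (Suc i mod length c)} \<in> snd G)"

definition hamiltonian_cycle :: "'v graph \<Rightarrow> 'v list \<Rightarrow> bool" where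
  "hamiltonian_cycle G c \<longleftrightarrow> simple_cycle G c \<and> set c = fst G"

end

theory Submission
  imports Defs
begin

text \<open>
  Let $L$ be the $(p,q)$-leaper and let $p < q$. A coordinate in \<open>{0..<p + q}\<close> that is less than
  \<open>p\<close> can only increase, by \<open>p\<close> or by \<open>q\<close>; one that is at least \<open>q\<close> can only decrease; and one
  in between admits no change by \<open>q\<close> and both changes by \<open>p\<close>. Hence every square has at most two
  $L$-neighbours (\<open>at_most_two_neighbours\<close>), the leaper graph is a union of disjoint cycles and
  isolated squares, and $C$ is determined by any one of its squares. It is therefore enough to
  find, through every non-isolated square, a closed tour of some other leaper $M$ whose squares
  form one connected component of the graph of $L$.

  All these tours have the same shape, described in the locale \<open>rosette\<close>. Up to a translation,
  the squares are \<open>(x t, x (t + m))\<close> for a function \<open>x\<close> on the integers such that the step from \<open>t\<close>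
  to \<open>t + 1\<close> is a move of $M$ and \<open>t \<mapsto> t + m\<close> is a quarter turn of the board, so that the tour closes
  up after \<open>4 * m\<close> steps. The two $L$-neighbours of the square with index \<open>t\<close> have the indices
  \<open>hop m t\<close> and \<open>hop m (t - a) + a\<close> (\<open>jump_hop\<close>, \<open>jump_hop'\<close>). Both maps are
  reflections modulo \<open>2 * m\<close>, and alternating them translates the index by \<open>2 * a\<close> modulo \<open>2 * m\<close>.
  Since \<open>a\<close> is odd, \<open>m\<close> is even and \<open>a\<close> and \<open>m\<close> are coprime, all \<open>4 * m\<close> indices lie in a single
  orbit (\<open>hop_orbit_full\<close>), that is, $L$ visits all squares of the tour in one cycle.

  Rosettes are constructed by a descent in \<open>p\<close> (\<open>covered_corner\<close>). Write \<open>q = 2 * j * p + \<sigma>\<close> or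
  \<open>q = 2 * j * p - \<sigma>\<close> with \<open>0 \<le> \<sigma> < p\<close>, and let $L'$ be the $(\sigma,p)$-leaper on the board of side
  \<open>\<sigma> + p\<close>. A square in the corner \<open>{0..<p} \<times> {0..<p}\<close> of the large board is identified with a
  square of the small one. If that square is isolated for $L'$, then the cycle of $L$ is explicit
  and $M$ is $L'$ itself (\<open>rosette_base\<close>). Otherwise a rosette of $L'$ passes through it; the part
  of that rosette inside this square of side \<open>p\<close> becomes the corner of a rosette of $L$, whose sides
  repeat it with alternating reflections, and $M$ stays the same
  (\<open>rosette_ascend_plus\<close>, \<open>rosette_ascend_minus\<close>). Every non-isolated square is reached from
  the corners by rotating the board and following moves of $L$ (\<open>covered_board\<close>). As $M$ has
  proportions at most \<open>p\<close>, it differs from $L$.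
\<close>

section \<open>Moves of a leaper and the degrees of its graph\<close>

text \<open>
  The coordinate differences of a move of the $(p,q)$-leaper, with integer proportions.
\<close>

definition jump :: "int \<Rightarrow> int \<Rightarrow> int \<Rightarrow> int \<Rightarrow> bool" where
  "jump p q u v \<longleftrightarrow> (\<bar>u\<bar> = p \<and> \<bar>v\<bar> = q) \<or> (\<bar>u\<bar> = q \<and> \<bar>v\<bar> = p)"

lemma jump_rotate: "jump p q v (- u) \<longleftrightarrow> jump p q u v"
  by (auto simp: jump_def)

lemma leaper_move_iff_jump:
  "leaper_move p q z z' \<longleftrightarrow> jump (int p) (int q) (fst z' - fst z) (snd z' - snd z)"
proof -
  have abs_iff: "\<bar>d\<bar> = int k \<longleftrightarrow> d = int k \<or> d = - int k" for d k
    by auto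
  have shift: "z' = z + (u, v) \<longleftrightarrow> fst z' - fst z = u \<and> snd z' - snd z = v" for u v
    by (cases z; cases z') auto
  show ?thesis
    unfolding leaper_move_def jump_def abs_iff shift by auto
qed

text \<open>
  This is where the side \<open>p + q\<close> of the board matters: a change of a coordinate by \<open>p\<close> and one by
  \<open>q\<close> are each possible in only one direction, except that a coordinate in \<open>{p..<q}\<close> can change
  by \<open>p\<close> in both directions and not at all by \<open>q\<close>. A move combines one change of each kind.
\<close>

lemma at_most_two_neighbours:
  fixes p q X Y :: int
  assumes "0 \<le> p" "p < q"
  defines "nbr \<equiv> \<lambda>X' Y'. jump p q (X' - X) (Y' - Y) \<and>
      0 \<le> X' \<and> X' < p + q \<and> 0 \<le> Y' \<and> Y' < p + q"
  assumes "0 \<le> X" "X < p + q" "0 \<le> Y" "Y < p + q"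
  shows "\<exists>b c. \<forall>X' Y'. nbr X' Y' \<longrightarrow> (X', Y') = b \<or> (X', Y') = c"
proof -
  \<comment> \<open>Away from \<open>{p..<q}\<close>, \<open>dp Z\<close> and \<open>dq Z\<close> are the only possible changes of the coordinate \<open>Z\<close>.\<close>
  define dp where "dp Z = (if Z < q then p else - p)" for Z
  define dq where "dq Z = (if Z < p then q else - q)" for Z
  have zone: "(X' - X = p \<and> X < q \<or> X' - X = - p \<and> p \<le> X) \<and>
      (Y' - Y = q \<and> Y < p \<or> Y' - Y = - q \<and> q \<le> Y) \<or>
      (X' - X = q \<and> X < p \<or> X' - X = - q \<and> q \<le> X) \<and>
      (Y' - Y = p \<and> Y < q \<or> Y' - Y = - p \<and> p \<le> Y)" if "nbr X' Y'" for X' Y'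
  proof -
    have abs_iff: "\<bar>d\<bar> = k \<Longrightarrow> d = k \<or> d = - k" for d k :: int
      by linarith
    have "(X' - X = p \<or> X' - X = - p) \<and> (Y' - Y = q \<or> Y' - Y = - q) \<or>
        (X' - X = q \<or> X' - X = - q) \<and> (Y' - Y = p \<or> Y' - Y = - p)"
      using that abs_iff unfolding nbr_def jump_def by blast
    moreover have "0 \<le> X'" "X' < p + q" "0 \<le> Y'" "Y' < p + q"
      using that by (simp_all add: nbr_def)
    ultimately show ?thesis
      by (elim disjE conjE; simp)
  qed
  consider "p \<le> X" "X < q" | "p \<le> Y" "Y < q" | "X < p \<or> q \<le> X" "Y < p \<or> q \<le> Y"
    by linarith
  then show ?thesis
  proof cases
    case 1
    have "(X', Y') = (X + p, Y + dq Y) \<or> (X', Y') = (X - p, Y + dq Y)" if "nbr X' Y'" for X' Y'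
      using zone[OF that] 1 assms(1,2) unfolding dq_def
      by (elim disjE conjE; simp)
    then show ?thesis by blast
  next
    case 2
    have "(X', Y') = (X + dq X, Y + p) \<or> (X', Y') = (X + dq X, Y - p)" if "nbr X' Y'" for X' Y'
      using zone[OF that] 2 assms(1,2) unfolding dq_def
      by (elim disjE conjE; simp)
    then show ?thesis by blast
  next
    case 3
    have "(X', Y') = (X + dp X, Y + dq Y) \<or> (X', Y') = (X + dq X, Y + dp Y)"
      if "nbr X' Y'" for X' Y'
      using zone[OF that] 3 assms(1,2) unfolding dp_def dq_def
      by (elim disjE conjE; simp)
    then show ?thesis by blast
  qed
qed

section \<open>Rosettes\<close>

lemma int_translation_induct:
  fixes c :: int
  assumes "0 < c" and "\<And>t. P (t + c) \<longleftrightarrow> P t" and "\<And>t. 0 \<le> t \<Longrightarrow> t < c \<Longrightarrow> P t"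
  shows "P t"
proof -
  have nat_shift: "P (u + c * int n) \<longleftrightarrow> P u" for u n
  proof (induction n)
    case (Suc n)
    have "u + c * int (Suc n) = (u + c * int n) + c" by (simp add: algebra_simps)
    then show ?case using assms(2) Suc by metis
  qed simp
  have "P (u + c * k) \<longleftrightarrow> P u" for u k
  proof (cases "0 \<le> k")
    case True
    then show ?thesis using nat_shift[of u "nat k"] by simp
  next
    case False
    then show ?thesis using nat_shift[of "u + c * k" "nat (- k)"] by simp
  qed
  from this[of "t mod c" "t div c"] show ?thesis
    using assms(1,3) by simp
qed

text \<open>
  A rosette is a closed tour \<open>t \<mapsto> (x t, x (t + m))\<close> of the $(r,s)$-leaper in the square
  \<open>{0..w} \<times> {0..w}\<close> whose squares form a cycle of the $(p,q)$-leaper. By \<open>half_turn\<close>, the shift of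
  the index by \<open>m\<close> maps \<open>(X, Y)\<close> to \<open>(Y, w - X)\<close>, a quarter turn, so \<open>4 * m\<close> is a period; \<open>diagonal\<close>
  says that the tour is symmetric in the main diagonal. The indices \<open>{0..<a}\<close> form the corner
  where both coordinates are less than \<open>p\<close>, and the indices \<open>{a..<m}\<close> the side where the first
  coordinate is less than \<open>p\<close> and the second lies between \<open>p\<close> and \<open>q\<close>; the other corners and sides
  are obtained by quarter turns. On \<open>{0..<m}\<close>, the assumptions \<open>fold\<close> and \<open>climb\<close> together state
  that the shift of the index by \<open>a\<close> is a reflection \<open>X \<mapsto> (w - q) - X\<close> combined with the
  translation \<open>Y \<mapsto> Y + p\<close>; followed by the reflection \<open>X \<mapsto> w - X\<close> of the whole tour, this is a move
  of the $(p,q)$-leaper. Since \<open>w < p + q\<close>, the tour fits into the board in \<open>p + q - w\<close> horizontal and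
  as many vertical positions.
\<close>

locale rosette =
  fixes x :: "int \<Rightarrow> int" and a m p q w r s :: int
  assumes a_pos: "0 < a" and a_less: "a < m" and odd_a: "odd a" and even_m: "even m"
    and coprime_am: "coprime a m"
    and r_nonneg: "0 \<le> r" and r_le: "r \<le> s" and s_pos: "0 < s" and s_le: "s \<le> p"
    and p_less: "p < q" and w_less: "w < p + q"
    and half_turn: "x (t + 2 * m) = w - x t"
    and diagonal: "x (a - 1 - t) = x (t + m)"
    and fold: "0 \<le> t \<Longrightarrow> t < m \<Longrightarrow> x t + x (t + a) = w - q"
    and climb: "m \<le> t \<Longrightarrow> t < 2 * m \<Longrightarrow> x (t + a) = x t + p"
    and outer: "0 \<le> t \<Longrightarrow> t < m + a \<Longrightarrow> 0 \<le> x t \<and> x t \<le> w - q"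
    and inner: "m + a \<le> t \<Longrightarrow> t < 2 * m \<Longrightarrow> p \<le> x t \<and> x t \<le> w - p"
    and step: "jump r s (x (t + 1) - x t) (x (t + 1 + m) - x (t + m))"
    and injective: "x t = x u \<Longrightarrow> x (t + m) = x (u + m) \<Longrightarrow> 4 * m dvd t - u"

text \<open>
  A rosette is determined by its first corner. The functions \<open>U\<close> and \<open>V\<close> are the two coordinates,
  extended from the corner \<open>{0..<a}\<close> to all indices by the rule that a shift by \<open>a\<close> reflects the
  first coordinate and translates the second; they agree with the tour on \<open>{0..<m + a}\<close>. The
  conditions \<open>U_glue\<close> and \<open>V_glue\<close> say that the second corner, which has the indices \<open>m + t\<close>, is
  the first one after a quarter turn.
\<close>

lemma rosette_extension:
  fixes U V :: "int \<Rightarrow> int" and a m p q w r s :: int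
  defines "\<omega> \<equiv> w - q"
  assumes "0 < a" "a < m" "odd a" "even m" "coprime a m"
    and "0 \<le> r" "r \<le> s" "0 < s" "s \<le> p" "p < q" and \<omega>_less: "\<omega> < p"
    and U_shift: "\<And>t. U (t + a) = \<omega> - U t" and V_shift: "\<And>t. V (t + a) = V t + p"
    and VU: "\<And>t. 0 \<le> t \<Longrightarrow> t < a \<Longrightarrow> V t = U (a - 1 - t)"
    and U_glue: "\<And>t. 0 \<le> t \<Longrightarrow> t < a \<Longrightarrow> U (m + t) = V t"
    and V_glue: "\<And>t. 0 \<le> t \<Longrightarrow> t < a \<Longrightarrow> V (m + t) = w - U t"
    and range: "\<And>t. 0 \<le> t \<Longrightarrow> t < a \<Longrightarrow> 0 \<le> U t \<and> U t \<le> \<omega>"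
    and inj: "\<And>t u. 0 \<le> t \<Longrightarrow> t < a \<Longrightarrow> 0 \<le> u \<Longrightarrow> u < a \<Longrightarrow> U t = U u \<Longrightarrow> V t = V u \<Longrightarrow> t = u"
    and stp: "\<And>t. 0 \<le> t \<Longrightarrow> t < a \<Longrightarrow> jump r s (U (t + 1) - U t) (V (t + 1) - V t)"
  obtains x where "rosette x a m p q w r s"
    and "\<And>t. 0 \<le> t \<Longrightarrow> t < a \<Longrightarrow> x t = U t \<and> x (t + m) = V t"
proof -
  note a_pos = \<open>0 < a\<close> and a_less = \<open>a < m\<close>
  have range_all: "0 \<le> U t \<and> U t \<le> \<omega>" for t
    by (rule int_translation_induct[OF a_pos]) (use U_shift range in auto)
  have U_sym: "U t = U (m + a - 1 - t)" for t
  proof (rule int_translation_induct[OF a_pos, of "\<lambda>t. U t = U (m + a - 1 - t)"])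
    fix t
    have "U (m + a - 1 - t) = \<omega> - U (m + a - 1 - (t + a))"
      using U_shift[of "m + a - 1 - (t + a)"] by (simp add: algebra_simps)
    then show "(U (t + a) = U (m + a - 1 - (t + a))) \<longleftrightarrow> (U t = U (m + a - 1 - t))"
      using U_shift[of t] by auto
  next
    fix t assume "0 \<le> t" "t < a"
    then show "U t = U (m + a - 1 - t)"
      using U_glue[of "a - 1 - t"] VU[of "a - 1 - t"] by (simp add: algebra_simps)
  qed
  have V_sym: "V t + V (m + a - 1 - t) = w" for t
  proof (rule int_translation_induct[OF a_pos, of "\<lambda>t. V t + V (m + a - 1 - t) = w"])
    fix t
    have "V (m + a - 1 - t) = V (m + a - 1 - (t + a)) + p"
      using V_shift[of "m + a - 1 - (t + a)"] by (simp add: algebra_simps)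
    then show "(V (t + a) + V (m + a - 1 - (t + a)) = w) \<longleftrightarrow> (V t + V (m + a - 1 - t) = w)"
      using V_shift[of t] by auto
  next
    fix t assume "0 \<le> t" "t < a"
    then show "V t + V (m + a - 1 - t) = w"
      using V_glue[of "a - 1 - t"] VU[of t] by (simp add: algebra_simps)
  qed
  have stp_all: "jump r s (U (t + 1) - U t) (V (t + 1) - V t)" for t
  proof (rule int_translation_induct[OF a_pos, of "\<lambda>t. jump r s (U (t + 1) - U t) (V (t + 1) - V t)"])
    fix t
    have "U (t + a + 1) - U (t + a) = - (U (t + 1) - U t)"
      and "V (t + a + 1) - V (t + a) = V (t + 1) - V t"
      using U_shift[of t] U_shift[of "t + 1"] V_shift[of t] V_shift[of "t + 1"]
      by (simp_all add: algebra_simps)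
    then show "jump r s (U (t + a + 1) - U (t + a)) (V (t + a + 1) - V (t + a)) \<longleftrightarrow>
        jump r s (U (t + 1) - U t) (V (t + 1) - V t)"
      by (simp only: jump_def abs_minus_cancel)
  qed (use stp in auto)
  \<comment> \<open>The values of the tour on half a period, and their continuation by half turns.\<close>
  define v where "v t = (if t < m then U t else V (t - m))" for t
  define x where "x t = (if even (t div (2 * m)) then v (t mod (2 * m)) else w - v (t mod (2 * m)))" for t
  have m_pos: "0 < m" using a_pos a_less by simp
  have half: "x (t + 2 * m) = w - x t" for t
  proof -
    have "(t + 2 * m) div (2 * m) = t div (2 * m) + 1"
      using m_pos by (intro div_add_self2) simp
    then show ?thesis by (simp add: x_def)
  qed
  have x_small: "x t = v t" if "0 \<le> t" "t < 2 * m" for t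
    using that by (simp add: x_def div_pos_pos_trivial)
  have xU: "x t = U t" if "0 \<le> t" "t < m + a" for t
    using that U_glue[of "t - m"] a_less by (auto simp: x_small v_def)
  have xV: "x (t + m) = V t" if "0 \<le> t" "t < m + a" for t
  proof (cases "t < m")
    case True
    then show ?thesis using that by (simp add: x_small v_def)
  next
    case False
    then show ?thesis
      using that half[of "t - m"] xU[of "t - m"] V_glue[of "t - m"] a_less by (simp add: algebra_simps)
  qed
  have full: "x (t + 4 * m) = x t" for t
    using half[of t] half[of "t + 2 * m"] by (simp add: algebra_simps)
  have div_a: "(t + a) div a = t div a + 1" for t
    using a_pos by (intro div_add_self2) simp
  have U_mod: "U t = (if even (t div a) then U (t mod a) else \<omega> - U (t mod a))" for t
    by (rule int_translation_induct[OF a_pos,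
          of "\<lambda>t. U t = (if even (t div a) then U (t mod a) else \<omega> - U (t mod a))"])
      (use a_pos in \<open>auto simp: U_shift div_a\<close>)
  have V_mod: "V t = V (t mod a) + p * (t div a)" for t
    by (rule int_translation_induct[OF a_pos, of "\<lambda>t. V t = V (t mod a) + p * (t div a)"])
      (use a_pos in \<open>auto simp: V_shift div_a distrib_left\<close>)
  have V_corner: "0 \<le> V (t mod a) \<and> V (t mod a) < p" for t
    using VU[of "t mod a"] range_all[of "a - 1 - t mod a"] \<omega>_less a_pos by simp
  have p_pos: "0 < p" using V_corner[of 0] by simp
  have V_div: "V t div p = t div a" for t
    using V_mod[of t] V_corner[of t] p_pos by (simp add: div_pos_pos_trivial)
  have V_ge: "p \<le> V t" if "a \<le> t" for t
  proof -
    have "1 \<le> V t div p" using that a_pos zdiv_mono1[of a t a] by (simp add: V_div)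
    then have "p * 1 \<le> p * (V t div p)" using p_pos by (intro mult_left_mono) auto
    also have "\<dots> \<le> V t" using p_pos by (simp add: minus_mod_eq_mult_div[symmetric])
    finally show ?thesis by simp
  qed
  have UV_inj: "t = u" if "U t = U u" "V t = V u" for t u
  proof -
    have "t div a = u div a" using that(2) V_div by metis
    moreover from this have "U (t mod a) = U (u mod a)"
      using that(1) U_mod[of t] U_mod[of u] by (auto split: if_splits)
    moreover have "V (t mod a) = V (u mod a)"
      using that(2) V_mod[of t] V_mod[of u] calculation(1) by simp
    ultimately have "t div a = u div a" "t mod a = u mod a"
      using inj[of "t mod a" "u mod a"] a_pos by simp_all
    then show ?thesis by (metis div_mult_mod_eq)
  qed
  have "rosette x a m p q w r s"
  proof
    show "x (a - 1 - t) = x (t + m)" for t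
    proof (rule int_translation_induct[of "2 * m" "\<lambda>t. x (a - 1 - t) = x (t + m)"])
      fix t
      have "x (a - 1 - t) = w - x (a - 1 - (t + 2 * m))"
        using half[of "a - 1 - (t + 2 * m)"] by (simp add: algebra_simps)
      moreover have "x (t + 2 * m + m) = w - x (t + m)"
        using half[of "t + m"] by (simp add: algebra_simps)
      ultimately show "x (a - 1 - (t + 2 * m)) = x (t + 2 * m + m) \<longleftrightarrow> x (a - 1 - t) = x (t + m)"
        by auto
    next
      fix t assume t: "0 \<le> t" "t < 2 * m"
      have refl: "x (a - 1 - t) = w - x (2 * m + a - 1 - t)"
        using half[of "a - 1 - t"] by (simp add: algebra_simps)
      show "x (a - 1 - t) = x (t + m)"
      proof (cases "t < m")
        case True
        then have "x (2 * m + a - 1 - t) = V (m + a - 1 - t)"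
          using xV[of "m + a - 1 - t"] t a_pos by (simp add: algebra_simps)
        then show ?thesis using refl V_sym[of t] xV[of t] True t a_pos by simp
      next
        case False
        then have "x (2 * m + a - 1 - t) = U (t - m)"
          using xU[of "2 * m + a - 1 - t"] U_sym[of "t - m"] t a_pos by (simp add: algebra_simps)
        moreover have "x (t + m) = w - U (t - m)"
          using half[of "t - m"] xU[of "t - m"] False t a_pos by (simp add: algebra_simps)
        ultimately show ?thesis using refl by simp
      qed
    qed (use m_pos in simp)
    show "x t + x (t + a) = w - q" if "0 \<le> t" "t < m" for t
      using that xU[of t] xU[of "t + a"] U_shift[of t] a_pos by (simp add: \<omega>_def)
    show "x (t + a) = x t + p" if "m \<le> t" "t < 2 * m" for t
      using that xV[of "t - m"] xV[of "t - m + a"] V_shift[of "t - m"] a_pos by simp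
    show "0 \<le> x t \<and> x t \<le> w - q" if "0 \<le> t" "t < m + a" for t
      using that xU[of t] range_all[of t] by (simp add: \<omega>_def)
    show "p \<le> x t \<and> x t \<le> w - p" if "m + a \<le> t" "t < 2 * m" for t
      using that xV[of "t - m"] V_ge[of "t - m"] V_ge[of "m + a - 1 - (t - m)"] V_sym[of "t - m"] a_pos
      by simp
    show "jump r s (x (t + 1) - x t) (x (t + 1 + m) - x (t + m))" for t
    proof (rule int_translation_induct[OF m_pos,
          of "\<lambda>t. jump r s (x (t + 1) - x t) (x (t + 1 + m) - x (t + m))"])
      fix t
      have "x (t + m + 1 + m) - x (t + m + m) = - (x (t + 1) - x t)"
        using half[of t] half[of "t + 1"] by (simp add: algebra_simps)
      then show "jump r s (x (t + m + 1) - x (t + m)) (x (t + m + 1 + m) - x (t + m + m)) \<longleftrightarrow>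
          jump r s (x (t + 1) - x t) (x (t + 1 + m) - x (t + m))"
        using jump_rotate[of r s "x (t + m + 1) - x (t + m)" "x (t + 1) - x t"]
        by (simp add: add.commute add.left_commute)
    next
      fix t assume "0 \<le> t" "t < m"
      then show "jump r s (x (t + 1) - x t) (x (t + 1 + m) - x (t + m))"
        using xU[of t] xU[of "t + 1"] xV[of t] xV[of "t + 1"] stp_all[of t] a_pos by simp
    qed
    \<comment> \<open>Whether two squares coincide can be tested after moving the first index into \<open>{0..<m}\<close>: the
      coordinate ranges then force the second index into the same quarter.\<close>
    have xV_le: "0 \<le> x (t + m) \<and> x (t + m) \<le> w - p" if "0 \<le> t" "t < m" for t
    proof -
      have "0 \<le> V t"
        using V_mod[of t] V_corner[of t] p_pos that a_pos
        by (simp add: pos_imp_zdiv_nonneg_iff)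
      moreover have "V t = w - V (m + a - 1 - t)" "a \<le> m + a - 1 - t"
        using V_sym[of t] that by simp_all
      ultimately show ?thesis
        using V_ge[of "m + a - 1 - t"] xV[of t] that a_pos by simp
    qed
    have xU_le: "0 \<le> x t \<and> x t \<le> \<omega>" if "0 \<le> t" "t < m" for t
      using that xU[of t] range_all[of t] a_pos by simp
    define same where "same t u \<longleftrightarrow> x t = x u \<and> x (t + m) = x (u + m)" for t u
    have same_m: "same (t + m) (u + m) \<longleftrightarrow> same t u" for t u
      using half[of t] half[of u] by (auto simp: same_def algebra_simps)
    have full': "x (t + m * 4) = x t" for t
      using full[of t] by (simp add: mult.commute)
    have same_4m: "same t (u + 4 * m) \<longleftrightarrow> same t u" for t u
      using full[of u] full[of "u + m"] by (simp add: same_def algebra_simps full')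
    have "\<forall>u. same t u \<longrightarrow> 4 * m dvd t - u" for t
    proof (rule int_translation_induct[OF m_pos, of "\<lambda>t. \<forall>u. same t u \<longrightarrow> 4 * m dvd t - u"])
      fix t
      show "(\<forall>u. same (t + m) u \<longrightarrow> 4 * m dvd t + m - u) \<longleftrightarrow>
          (\<forall>u. same t u \<longrightarrow> 4 * m dvd t - u)"
      proof safe
        fix u assume "\<forall>u. same (t + m) u \<longrightarrow> 4 * m dvd t + m - u" "same t u"
        then show "4 * m dvd t - u" using same_m[of t u] by force
      next
        fix u assume "\<forall>u. same t u \<longrightarrow> 4 * m dvd t - u" "same (t + m) u"
        then show "4 * m dvd t + m - u" using same_m[of t "u - m"] by (force simp: algebra_simps)
      qed
    next
      fix t assume t: "0 \<le> t" "t < m"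
      have "same t u \<longrightarrow> 4 * m dvd t - u" for u
      proof (rule int_translation_induct[of "4 * m" "\<lambda>u. same t u \<longrightarrow> 4 * m dvd t - u"])
        fix u
        have "4 * m dvd t - (u + 4 * m) \<longleftrightarrow> 4 * m dvd t - u"
          using dvd_add_left_iff[of "4 * m" "4 * m" "t - (u + 4 * m)"] by (simp add: algebra_simps)
        then show "(same t (u + 4 * m) \<longrightarrow> 4 * m dvd t - (u + 4 * m)) \<longleftrightarrow>
            (same t u \<longrightarrow> 4 * m dvd t - u)"
          by (simp add: same_4m)
      next
        fix u assume u: "0 \<le> u" "u < 4 * m"
        have two: "x (u' + 2 * m) = w - x u'" "x (u' + 3 * m) = w - x (u' + m)" for u'
          using half[of u'] half[of "u' + m"] by (simp_all add: algebra_simps)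
        have "same t u \<longrightarrow> t = u"
        proof (rule impI)
          assume eq: "same t u"
          consider "u < m" | "m \<le> u" "u < 2 * m" | "2 * m \<le> u" "u < 3 * m" | "3 * m \<le> u"
            by linarith
          then show "t = u"
          proof cases
            case 1
            then show ?thesis
              using UV_inj[of t u] eq xU[of t] xU[of u] xV[of t] xV[of u] t u a_pos
              by (simp add: same_def)
          next
            case 2
            then show ?thesis
              using eq two[of "u - m"] xV_le[OF t] xU_le[of "u - m"] \<omega>_less
              by (simp add: same_def \<omega>_def add.commute)
          next
            case 3
            then show ?thesis
              using eq two[of "u - 2 * m"] xU_le[OF t] xU_le[of "u - 2 * m"] \<omega>_less \<open>p < q\<close>
              by (simp add: same_def \<omega>_def add.commute)
          next
            case 4
            then show ?thesis
              using eq two[of "u - 3 * m"] xU_le[OF t] xV_le[of "u - 3 * m"] \<omega>_less u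
              by (simp add: same_def \<omega>_def add.commute)
          qed
        qed
        then show "same t u \<longrightarrow> 4 * m dvd t - u" by auto
      qed (use m_pos in simp)
      then show "\<forall>u. same t u \<longrightarrow> 4 * m dvd t - u" by blast
    qed
    then show "4 * m dvd t - u" if "x t = x u" "x (t + m) = x (u + m)" for t u
      using that by (auto simp: same_def)
  qed (use assms half in \<open>auto simp: \<omega>_def\<close>)
  moreover have "x t = U t \<and> x (t + m) = V t" if "0 \<le> t" "t < a" for t
    using that xU[of t] xV[of t] a_less a_pos by simp
  ultimately show ?thesis using that by blast
qed

section \<open>Construction of rosettes\<close>

text \<open>
  The bottom of the descent, where the corner is the single square \<open>(x0, x0)\<close>. The choices \<open>x0 = 0\<close>
  and \<open>x0 = \<sigma>\<close> belong to \<open>q = 2 * j * p - \<sigma>\<close> and \<open>q = 2 * j * p + \<sigma>\<close>.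
\<close>

lemma rosette_base:
  fixes j p \<sigma> x0 :: int
  assumes "1 \<le> j" "0 \<le> \<sigma>" "\<sigma> < p" and x0: "x0 = 0 \<or> x0 = \<sigma>"
    and p_less: "p < 2 * j * p + 2 * x0 - \<sigma>"
  obtains x where "rosette x 1 (2 * j) p (2 * j * p + 2 * x0 - \<sigma>) (2 * j * p + 2 * x0) \<sigma> p"
    and "x 0 = x0" and "x (2 * j) = x0"
proof -
  define U where "U t = (if even t then x0 else \<sigma> - x0)" for t :: int
  define V where "V t = x0 + t * p" for t :: int
  have "0 \<le> x0" "x0 \<le> \<sigma>" using x0 assms by auto
  have unit: "t = 0" if "0 \<le> t" "t < 1" for t :: int using that by simp
  have "\<exists>x. rosette x 1 (2 * j) p (2 * j * p + 2 * x0 - \<sigma>) (2 * j * p + 2 * x0) \<sigma> p \<and>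
      (\<forall>t. 0 \<le> t \<longrightarrow> t < 1 \<longrightarrow> x t = U t \<and> x (t + 2 * j) = V t)"
  proof (rule rosette_extension[of 1 "2 * j" \<sigma> p p "2 * j * p + 2 * x0 - \<sigma>" "2 * j * p + 2 * x0" U V])
    show "jump \<sigma> p (U (t + 1) - U t) (V (t + 1) - V t)" if "0 \<le> t" "t < 1" for t
      using unit[OF that] x0 assms by (auto simp: U_def V_def jump_def)
    show "V t = U (1 - 1 - t)" "U (2 * j + t) = V t" "V (2 * j + t) = 2 * j * p + 2 * x0 - U t"
      "0 \<le> U t \<and> U t \<le> 2 * j * p + 2 * x0 - (2 * j * p + 2 * x0 - \<sigma>)" if "0 \<le> t" "t < 1" for t
      using unit[OF that] \<open>0 \<le> x0\<close> \<open>x0 \<le> \<sigma>\<close> by (simp_all add: U_def V_def)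
  qed (use assms in \<open>auto simp: U_def V_def algebra_simps\<close>)
  then show ?thesis using that by (auto simp: U_def V_def)
qed

lemma quasiperiodic_extension:
  fixes S T :: "int \<Rightarrow> int" and a p \<omega> :: int
  assumes "0 < a"
  obtains U V where "\<And>t. U (t + a) = \<omega> - U t" and "\<And>t. V (t + a) = V t + p"
    and "\<And>t. 0 \<le> t \<Longrightarrow> t < a \<Longrightarrow> U t = S t" and "\<And>t. 0 \<le> t \<Longrightarrow> t < a \<Longrightarrow> V t = T t"
proof -
  define U where "U t = (if even (t div a) then S (t mod a) else \<omega> - S (t mod a))" for t
  define V where "V t = T (t mod a) + p * (t div a)" for t
  have div_a: "(t + a) div a = t div a + 1" for t
    using assms by (intro div_add_self2) simp
  show ?thesis
    by (rule that[of U V]) (auto simp: U_def V_def div_a distrib_left div_pos_pos_trivial)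
qed

lemma quasiperiodic_double:
  fixes U V :: "int \<Rightarrow> int" and a p \<omega> j :: int
  assumes "\<And>t. U (t + a) = \<omega> - U t" and "\<And>t. V (t + a) = V t + p" and "0 \<le> j"
  shows "U (t + 2 * j * a) = U t \<and> V (t + 2 * j * a) = V t + 2 * j * p"
  using assms(3)
proof (induction j rule: int_ge_induct)
  case (step i)
  have "t + 2 * (i + 1) * a = t + 2 * i * a + a + a" by (simp add: algebra_simps)
  then show ?case
    using step assms(1)[of "t + 2 * i * a"] assms(1)[of "t + 2 * i * a + a"]
      assms(2)[of "t + 2 * i * a"] assms(2)[of "t + 2 * i * a + a"]
    by (simp add: algebra_simps)
qed simp

context rosette
begin

lemma m_pos: "0 < m"
  using a_pos a_less by simp

lemma p_pos: "0 < p"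
  using s_pos s_le by simp

lemma half_turn_back: "x (t - 2 * m) = w - x t"
  using half_turn[of "t - 2 * m"] by simp

lemma climb_back:
  assumes "- m \<le> t" "t < 0"
  shows "x (t + a) = x t - p"
  using climb[of "t + 2 * m"] half_turn[of t] half_turn[of "t + a"] assms
  by (simp add: algebra_simps)

text \<open>
  In the next lemmas \<open>m - a\<close> is the number of squares on a side of the rosette. The corner of the
  larger rosette consists of the squares with indices \<open>{- (m - a)..<m}\<close>: a side, a corner and
  the next side. In terms of \<open>t\<close> in \<open>{0..<2 * m - a}\<close>, the coordinates of these squares are
  \<open>x (t - (m - a))\<close> and \<open>x (t + a)\<close>.
\<close>

lemma opposite_side:
  assumes "0 \<le> t" "t < m"
  shows "x (t - (m - a)) + x (t + m) = w - p"
  using climb_back[of "t - m"] half_turn[of "t - m"] assms by (simp add: algebra_simps)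

lemma opposite_fold:
  assumes "0 \<le> t" "t < m"
  shows "x (t - m - (m - a)) = x t + q"
  using fold[of t] half_turn[of "t - m - (m - a)"] assms by (simp add: algebra_simps)

lemma seed_range:
  assumes "0 \<le> t" "t < 2 * m - a"
  shows "0 \<le> x (t - (m - a)) \<and> x (t - (m - a)) \<le> w - p"
proof (cases "t < m - a")
  case True
  then show ?thesis
    using inner[of "t - (m - a) + 2 * m"] half_turn[of "t - (m - a)"] assms p_pos
    by (simp add: algebra_simps)
next
  case False
  then show ?thesis using outer[of "t - (m - a)"] assms a_less a_pos p_less by simp
qed

lemma seed_range':
  assumes "0 \<le> t" "t < 2 * m - a"
  shows "0 \<le> x (t + a) \<and> x (t + a) \<le> w - p"
proof (cases "t < m")
  case True
  then show ?thesis using outer[of "t + a"] assms a_pos p_less by simp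
next
  case False
  then show ?thesis using inner[of "t + a"] assms p_pos by simp
qed

lemma seed_diagonal: "x (t + a) = x (2 * m - a - 1 - t - (m - a))"
  using diagonal[of "t + a - m"] by (simp add: algebra_simps)

lemma seed_injective:
  assumes "0 \<le> t" "t < 2 * m - a" "0 \<le> u" "u < 2 * m - a"
    and "x (t - (m - a)) = x (u - (m - a))" "x (t + a) = x (u + a)"
  shows "t = u"
proof -
  have "4 * m dvd (t - (m - a)) - (u - (m - a))"
    by (rule injective) (use assms(5,6) in \<open>simp_all add: algebra_simps\<close>)
  then have "4 * m dvd t - u" by simp
  moreover have "\<bar>t - u\<bar> < 4 * m" using assms m_pos a_pos by linarith
  ultimately show ?thesis
    using zdvd_imp_le[of "4 * m" "\<bar>t - u\<bar>"] by auto
qed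

lemma seed_step: "jump r s (x (t + 1 - (m - a)) - x (t - (m - a))) (x (t + 1 + a) - x (t + a))"
  using step[of "t - (m - a)"] by (simp add: algebra_simps)

lemma coprime_ascend:
  "coprime (2 * m - a) (2 * j * (2 * m - a) + m)"
  "coprime (2 * m - a) (2 * j * (2 * m - a) - m)"
proof -
  have unit: "is_unit c" if "c dvd 2 * m - a" "c dvd m" for c
  proof -
    have "c dvd 2 * m - (2 * m - a)" by (rule dvd_diff[OF dvd_mult[OF that(2)] that(1)])
    then show ?thesis using that coprime_common_divisor[OF coprime_am] by simp
  qed
  show "coprime (2 * m - a) (2 * j * (2 * m - a) + m)"
  proof (rule coprimeI)
    fix c assume c: "c dvd 2 * m - a" "c dvd 2 * j * (2 * m - a) + m"
    have "c dvd (2 * j * (2 * m - a) + m) - 2 * j * (2 * m - a)"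
      by (rule dvd_diff[OF c(2) dvd_mult[OF c(1)]])
    then show "is_unit c" using unit c by simp
  qed
  show "coprime (2 * m - a) (2 * j * (2 * m - a) - m)"
  proof (rule coprimeI)
    fix c assume c: "c dvd 2 * m - a" "c dvd 2 * j * (2 * m - a) - m"
    have "c dvd 2 * j * (2 * m - a) - (2 * j * (2 * m - a) - m)"
      by (rule dvd_diff[OF dvd_mult[OF c(1)] c(2)])
    then show "is_unit c" using unit c by simp
  qed
qed

text \<open>
  From a rosette of the $(p,q)$-leaper to one of the $(q, 2jq + p)$-leaper, both being tours of the
  same $(r,s)$-leaper. One quarter of the new rosette consists of \<open>2 * j\<close> copies of the new corner,
  alternately reflected, and \<open>m\<close> further squares.
\<close>

lemma rosette_ascend_plus:
  assumes "1 \<le> j"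
  obtains x' where "rosette x' (2 * m - a) (2 * j * (2 * m - a) + m) q (2 * j * q + p) (2 * j * q + w) r s"
    and "\<And>t. 0 \<le> t \<Longrightarrow> t < 2 * m - a \<Longrightarrow>
        x' t = x (t - (m - a)) \<and> x' (t + (2 * j * (2 * m - a) + m)) = x (t + a)"
proof -
  define A where "A = 2 * m - a"
  define M where "M = 2 * j * A + m"
  have A: "m < A" "0 < A" "odd A" using a_less m_pos odd_a by (auto simp: A_def)
  have jA: "2 * A \<le> 2 * j * A" and jq: "2 * q \<le> 2 * j * q"
    using assms A p_pos p_less by auto
  obtain U V where U: "\<And>t. U (t + A) = (w - p) - U t" and V: "\<And>t. V (t + A) = V t + q"
    and U0: "\<And>t. 0 \<le> t \<Longrightarrow> t < A \<Longrightarrow> U t = x (t - (m - a))"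
    and V0: "\<And>t. 0 \<le> t \<Longrightarrow> t < A \<Longrightarrow> V t = x (t + a)"
    using quasiperiodic_extension[OF A(2), where S = "\<lambda>t. x (t - (m - a))" and T = "\<lambda>t. x (t + a)"
        and p = q and \<omega> = "w - p"] by blast
  have UV: "U (t + 2 * j * A) = U t \<and> V (t + 2 * j * A) = V t + 2 * j * q" for t
    using quasiperiodic_double[of U A "w - p" V q j t] U V assms by simp
  \<comment> \<open>The extension follows the old rosette beyond the new corner, for another \<open>m\<close> steps. All
    remaining conditions at the boundary of the corner can be read off there.\<close>
  have window: "U t = x (t - (m - a)) \<and> V t = x (t + a)" if "0 \<le> t" "t < A + m" for t
  proof (cases "t < A")
    case False
    define u where "u = t - A"
    have u: "0 \<le> u" "u < m" "u < A" "t = u + A" using False that A by (auto simp: u_def)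
    have "x (u + A - (m - a)) = x (u + m)" "x (u + A + a) = x (u + 2 * m)"
      by (simp_all add: A_def algebra_simps)
    then show ?thesis
      using U[of u] U0[of u] V[of u] V0[of u] opposite_side[of u] fold[of u] half_turn[of u] u
      by simp
  qed (use U0 V0 that in auto)
  have \<omega>: "(2 * j * q + w) - (2 * j * q + p) = w - p" by simp
  have "\<exists>x'. rosette x' A M q (2 * j * q + p) (2 * j * q + w) r s \<and>
      (\<forall>t. 0 \<le> t \<longrightarrow> t < A \<longrightarrow> x' t = U t \<and> x' (t + M) = V t)"
  proof (rule rosette_extension[of A M r s q "2 * j * q + p" "2 * j * q + w" U V, unfolded \<omega>])
    show "odd A" "0 < A" by (fact A)+
    show "A < M" using A jA m_pos unfolding M_def by linarith
    show "even M" using even_m by (simp add: M_def)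
    show "coprime A M" using coprime_ascend by (simp add: A_def M_def)
    show "q < 2 * j * q + p" using jq p_pos p_less by linarith
    show "V t = U (A - 1 - t)" if "0 \<le> t" "t < A" for t
      using that window[of t] window[of "A - 1 - t"] seed_diagonal[of t] A m_pos by (simp add: A_def)
    show "U (M + t) = V t" if "0 \<le> t" "t < A" for t
      using that UV[of "m + t"] window[of "m + t"] window[of t] m_pos
      by (simp add: M_def algebra_simps)
    show "V (M + t) = 2 * j * q + w - U t" if "0 \<le> t" "t < A" for t
      using that UV[of "m + t"] window[of "m + t"] window[of t] m_pos half_turn[of "t - (m - a)"]
      by (simp add: M_def algebra_simps)
    show "0 \<le> U t \<and> U t \<le> w - p" if "0 \<le> t" "t < A" for t
      using that seed_range[of t] U0[of t] by (simp add: A_def)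
    show "t = u" if "0 \<le> t" "t < A" "0 \<le> u" "u < A" "U t = U u" "V t = V u" for t u
      using that seed_injective[of t u] U0 V0 by (simp add: A_def)
    show "jump r s (U (t + 1) - U t) (V (t + 1) - V t)" if "0 \<le> t" "t < A" for t
      using that seed_step[of t] window[of t] window[of "t + 1"] m_pos by simp
  qed (use U V r_nonneg r_le s_pos s_le p_less w_less in auto)
  then show ?thesis using that U0 V0 unfolding A_def M_def by metis
qed

text \<open>
  The analogous step to the $(q, 2jq - p)$-leaper. Its board is the previous one with a margin of
  width \<open>p\<close> removed on all sides, and the new corner is the opposite part of the old rosette,
  traversed backwards. By the symmetries of the rosette, its coordinates are \<open>w - p\<close> minus those
  of the preceding construction, in exchanged order.
\<close>

lemma rosette_ascend_minus:
  assumes "1 \<le> j"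
  obtains x' where
    "rosette x' (2 * m - a) (2 * j * (2 * m - a) - m) q (2 * j * q - p) (2 * j * q + w - 2 * p) r s"
    and "\<And>t. 0 \<le> t \<Longrightarrow> t < 2 * m - a \<Longrightarrow>
        x' t = w - p - x (t + a) \<and> x' (t + (2 * j * (2 * m - a) - m)) = w - p - x (t - (m - a))"
proof -
  define A where "A = 2 * m - a"
  define M where "M = 2 * j * A - m"
  have A: "m < A" "0 < A" "odd A" using a_less m_pos odd_a by (auto simp: A_def)
  have jA: "2 * A \<le> 2 * j * A" and jq: "2 * q \<le> 2 * j * q"
    using assms A p_pos p_less by auto
  obtain U V where U: "\<And>t. U (t + A) = (w - p) - U t" and V: "\<And>t. V (t + A) = V t + q"
    and U0: "\<And>t. 0 \<le> t \<Longrightarrow> t < A \<Longrightarrow> U t = w - p - x (t + a)"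
    and V0: "\<And>t. 0 \<le> t \<Longrightarrow> t < A \<Longrightarrow> V t = w - p - x (t - (m - a))"
    using quasiperiodic_extension[OF A(2), where S = "\<lambda>t. w - p - x (t + a)"
        and T = "\<lambda>t. w - p - x (t - (m - a))" and p = q and \<omega> = "w - p"] by blast
  have UV: "U (t + 2 * j * A) = U t \<and> V (t + 2 * j * A) = V t + 2 * j * q" for t
    using quasiperiodic_double[of U A "w - p" V q j t] U V assms by simp
  \<comment> \<open>As the old rosette is traversed backwards, it continues the new corner on the other side.\<close>
  have window: "U t = w - p - x (t + a) \<and> V t = w - p - x (t - (m - a))"
    if "- m \<le> t" "t < A" for t
  proof (cases "0 \<le> t")
    case False
    have u: "0 \<le> t + A" "t + A < A" using False that A by auto
    have "U t = w - p - x (t + a)"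
      using U[of t] U0[OF u] climb_back[of t] half_turn[of t] False that by (simp add: A_def algebra_simps)
    moreover have "V t = w - p - x (t - (m - a))"
      using V[of t] V0[OF u] opposite_fold[of "t + m"] False that by (simp add: A_def algebra_simps)
    ultimately show ?thesis by simp
  qed (use U0 V0 that in auto)
  have \<omega>: "(2 * j * q + w - 2 * p) - (2 * j * q - p) = w - p" by simp
  have "\<exists>x'. rosette x' A M q (2 * j * q - p) (2 * j * q + w - 2 * p) r s \<and>
      (\<forall>t. 0 \<le> t \<longrightarrow> t < A \<longrightarrow> x' t = U t \<and> x' (t + M) = V t)"
  proof (rule rosette_extension[of A M r s q "2 * j * q - p" "2 * j * q + w - 2 * p" U V, unfolded \<omega>])
    show "odd A" "0 < A" by (fact A)+
    show "A < M" using A jA m_pos unfolding M_def by linarith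
    show "even M" using even_m by (simp add: M_def)
    show "coprime A M" using coprime_ascend by (simp add: A_def M_def)
    show "q < 2 * j * q - p" using jq p_pos p_less by linarith
    show "V t = U (A - 1 - t)" if "0 \<le> t" "t < A" for t
      using that window[of t] window[of "A - 1 - t"] seed_diagonal[of "A - 1 - t"] A m_pos
      by (simp add: A_def algebra_simps)
    show "U (M + t) = V t" if "0 \<le> t" "t < A" for t
      using that UV[of "t - m"] window[of "t - m"] window[of t] m_pos
      by (simp add: M_def algebra_simps)
    show "V (M + t) = 2 * j * q + w - 2 * p - U t" if "0 \<le> t" "t < A" for t
      using that UV[of "t - m"] window[of "t - m"] window[of t] m_pos half_turn[of "t - m - (m - a)"]
      by (simp add: M_def algebra_simps)
    show "0 \<le> U t \<and> U t \<le> w - p" if "0 \<le> t" "t < A" for t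
      using that seed_range'[of t] U0[of t] by (simp add: A_def)
    show "t = u" if "0 \<le> t" "t < A" "0 \<le> u" "u < A" "U t = U u" "V t = V u" for t u
      using that seed_injective[of t u] U0 V0 by (simp add: A_def)
    show "jump r s (U (t + 1) - U t) (V (t + 1) - V t)" if "0 \<le> t" "t < A" for t
    proof (cases "t < A - 1")
      case True
      then have "U (t + 1) - U t = - (x (t + 1 + a) - x (t + a))"
        "V (t + 1) - V t = - (x (t + 1 - (m - a)) - x (t - (m - a)))"
        using that window[of t] window[of "t + 1"] m_pos by simp_all
      then show ?thesis using seed_step[of t] unfolding jump_def by (simp only: abs_minus_cancel) blast
    next
      case False
      then have t: "t = A - 1" using that by simp
      \<comment> \<open>The shift by \<open>- A\<close>, with its reflection, takes the last step to the one from \<open>- 1\<close> to \<open>0\<close>.\<close>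
      have "U (t + 1) - U t = x (0 + a) - x (- 1 + a)"
        "V (t + 1) - V t = - (x (0 - (m - a)) - x (- 1 - (m - a)))"
        using t U[of 0] U[of "- 1"] V[of 0] V[of "- 1"] window[of 0] window[of "- 1"] m_pos A
        by simp_all
      then show ?thesis using seed_step[of "- 1"] unfolding jump_def
        by (simp only: abs_minus_cancel) (simp, blast)
    qed
  qed (use U V r_nonneg r_le s_pos s_le p_less w_less in auto)
  then show ?thesis using that U0 V0 unfolding A_def M_def by metis
qed

end

section \<open>The cycle of the large leaper on a rosette\<close>

text \<open>
  For \<open>t\<close> in the block \<open>{k * m..<(k + 1) * m}\<close>, this is the order-reversing map onto the block
  \<open>{(k + 2) * m..<(k + 3) * m}\<close>. On the indices of a rosette it is one of the two perfect matchings
  formed by the moves of the $(p,q)$-leaper; conjugating it with the shift by \<open>a\<close> gives the other.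
\<close>

definition hop :: "int \<Rightarrow> int \<Rightarrow> int" where
  "hop m t = (2 * (t div m) + 3) * m - 1 - t"

lemma hop_shift:
  assumes "0 < m"
  shows "hop m (t + m) = hop m t + m"
proof -
  have "(t + m) div m = t div m + 1" using assms by (intro div_add_self2) simp
  then show ?thesis by (simp only: hop_def) (simp add: algebra_simps)
qed

lemma hop_base: "0 \<le> t \<Longrightarrow> t < m \<Longrightarrow> hop m t = 3 * m - 1 - t"
  by (simp add: hop_def div_pos_pos_trivial)

lemma hop_hop:
  assumes "0 < m"
  shows "hop m (hop m t - a) + a =
    t + 2 * a + 2 * m * ((t + a) div m - t div m) + 4 * m * (1 + t div m - (t + a) div m)"
proof -
  have "(hop m t - a) div m = 2 * (t div m) + 2 - (t + a) div m"
  proof (rule int_div_pos_eq)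
    show "hop m t - a = m * (2 * (t div m) + 2 - (t + a) div m) + (m - 1 - (t + a) mod m)"
      using div_mult_mod_eq[of "t + a" m] by (simp add: hop_def algebra_simps)
  qed (use assms pos_mod_sign[of m "t + a"] pos_mod_bound[of m "t + a"] in linarith)+
  then show ?thesis
    by (simp add: hop_def[of m "hop m t - a"]) (simp add: hop_def algebra_simps)
qed

text \<open>
  The summand grows by \<open>a\<close> when \<open>k\<close> grows by \<open>m\<close>, so the two halves of the sum differ by \<open>m * a\<close>.
\<close>

lemma even_sum_div:
  fixes a m t :: int
  assumes "0 < m" "even m"
  shows "even (\<Sum>k<2 * nat m. (t + int k * a) div m)"
proof -
  have split: "(\<Sum>k<M + N. g k) = (\<Sum>k<M. g k) + (\<Sum>k<N. g (M + k))" for g :: "nat \<Rightarrow> int" and M N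
    by (induction N) auto
  have shift: "(t + int (nat m + k) * a) div m = (t + int k * a) div m + a" for k
  proof -
    have "t + int (nat m + k) * a = (t + int k * a) + a * m"
      using assms by (simp add: algebra_simps)
    then show ?thesis using assms(1) by (simp only: div_mult_self1)
  qed
  have "(\<Sum>k<nat m + nat m. (t + int k * a) div m) =
      (\<Sum>k<nat m. (t + int k * a) div m) + (\<Sum>k<nat m. (t + int (nat m + k) * a) div m)"
    by (rule split)
  also have "\<dots> = 2 * (\<Sum>k<nat m. (t + int k * a) div m) + m * a"
    unfolding shift sum.distrib using assms(1) by simp
  finally have "even (\<Sum>k<nat m + nat m. (t + int k * a) div m)"
    using assms(2) by simp
  then show ?thesis by (simp only: mult_2)
qed

text \<open>
  Alternating the two reflections translates the index by \<open>2 * a\<close>, up to multiples of \<open>2 * m\<close>. The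
  number of these multiples after \<open>m\<close> double steps is even by \<open>even_sum_div\<close>, so that \<open>m\<close> double
  steps amount to \<open>2 * m * a\<close>, which is \<open>2 * m\<close> modulo the period \<open>4 * m\<close>. Thus the orbit is
  invariant under \<open>2 * m\<close>, hence under \<open>2 * a\<close>, hence under \<open>2\<close>; a single reflection changes the
  parity of the index.
\<close>

lemma hop_orbit_full:
  fixes a m :: int and K :: "int set"
  assumes m: "0 < m" and "odd a" "even m" "coprime a m"
    and period: "\<And>t. t + 4 * m \<in> K \<longleftrightarrow> t \<in> K"
    and hop: "\<And>t. t \<in> K \<Longrightarrow> hop m t \<in> K"
    and hop': "\<And>t. t \<in> K \<Longrightarrow> hop m (t - a) + a \<in> K"
    and "t0 \<in> K"
  shows "z \<in> K"
proof -
  have period_all: "t + 4 * m * i \<in> K \<longleftrightarrow> t \<in> K" for t i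
  proof (induction i rule: int_induct[of _ 0])
    case (step1 i)
    have eq: "t + 4 * m * (i + 1) = (t + 4 * m * i) + 4 * m" by (simp add: algebra_simps)
    show ?case unfolding eq period by (fact step1.IH)
  next
    case (step2 i)
    have eq: "t + 4 * m * i = (t + 4 * m * (i - 1)) + 4 * m" by (simp add: algebra_simps)
    show ?case using step2.IH unfolding eq period .
  qed simp
  have double: "t + 2 * a + 2 * m * ((t + a) div m - t div m) \<in> K" if "t \<in> K" for t
    using hop'[OF hop[OF that]] by (simp only: hop_hop[OF m] period_all)
  define c where "c t n = (\<Sum>l<n. (t + (2 * int l + 1) * a) div m - (t + 2 * int l * a) div m)" for t n
  have iterate: "t + 2 * a * int n + 2 * m * c t n \<in> K" if "t \<in> K" for t n
  proof (induction n)
    case (Suc n)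
    define u where "u = t + 2 * a * int n + 2 * m * c t n"
    have u: "u = (t + 2 * int n * a) + (2 * c t n) * m"
      and ua: "u + a = (t + (2 * int n + 1) * a) + (2 * c t n) * m"
      by (simp_all add: u_def algebra_simps)
    have "u div m = (t + 2 * int n * a) div m + 2 * c t n"
      unfolding u using m by (subst div_mult_self1) simp_all
    moreover have "(u + a) div m = (t + (2 * int n + 1) * a) div m + 2 * c t n"
      unfolding ua using m by (subst div_mult_self1) simp_all
    ultimately have "t + 2 * a * int (Suc n) + 2 * m * c t (Suc n) = u + 2 * a + 2 * m * ((u + a) div m - u div m)"
      by (simp add: u_def c_def algebra_simps)
    then show ?case using double[of u] Suc by (simp only: u_def)
  qed (use that in \<open>simp add: c_def\<close>)
  have "even (c t n + (\<Sum>k<2 * n. (t + int k * a) div m))" for t n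
  proof (induction n)
    case (Suc n)
    have eq: "c t (Suc n) + (\<Sum>k<2 * Suc n. (t + int k * a) div m) =
        (c t n + (\<Sum>k<2 * n. (t + int k * a) div m)) + 2 * ((t + (2 * int n + 1) * a) div m)"
      by (simp add: c_def add.commute)
    show ?case unfolding eq using Suc by simp
  qed (simp add: c_def)
  from this[of _ "nat m"] have even_c: "even (c t (nat m))" for t
    using even_sum_div[OF m \<open>even m\<close>, of t a] by simp
  obtain f where f: "a = 2 * f + 1" using \<open>odd a\<close> by (elim oddE)
  have half: "t + 2 * m \<in> K" if "t \<in> K" for t
  proof -
    obtain e where "c t (nat m) = 2 * e" using even_c[of t] by (elim evenE)
    then have eq: "t + 2 * a * int (nat m) + 2 * m * c t (nat m) = (t + 2 * m) + 4 * m * (f + e)"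
      using m f by (simp add: algebra_simps)
    show ?thesis using iterate[OF that, of "nat m"] unfolding eq period_all .
  qed
  have half_iff: "t + 2 * m \<in> K \<longleftrightarrow> t \<in> K" for t
    using half[of t] half[of "t + 2 * m"] period[of t] by (auto simp: algebra_simps)
  have half_all: "t + 2 * m * i \<in> K \<longleftrightarrow> t \<in> K" for t i
  proof (induction i rule: int_induct[of _ 0])
    case (step1 i)
    have eq: "t + 2 * m * (i + 1) = (t + 2 * m * i) + 2 * m" by (simp add: algebra_simps)
    show ?case unfolding eq half_iff by (fact step1.IH)
  next
    case (step2 i)
    have eq: "t + 2 * m * i = (t + 2 * m * (i - 1)) + 2 * m" by (simp add: algebra_simps)
    show ?case using step2.IH unfolding eq half_iff .
  qed simp
  have same_parity: "t + 2 * i \<in> K" if "t \<in> K" for t i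
  proof -
    obtain u v where uv: "u * a + v * m = 1"
      using bezout_int[of a m] \<open>coprime a m\<close> by auto
    \<comment> \<open>A number of double steps congruent to \<open>u * i\<close> modulo \<open>m\<close>, made nonnegative.\<close>
    define n where "n = nat (u * i + m * \<bar>u * i\<bar>)"
    have "1 * \<bar>u * i\<bar> \<le> m * \<bar>u * i\<bar>" using m by (intro mult_right_mono) auto
    then have n: "int n = u * i + m * \<bar>u * i\<bar>" unfolding n_def by linarith
    have eq: "t + 2 * a * int n + 2 * m * c t n =
        t + 2 * i * (u * a + v * m) + 2 * m * (a * \<bar>u * i\<bar> - v * i + c t n)"
      unfolding n by (simp add: algebra_simps)
    show ?thesis using iterate[OF that, of n] unfolding eq half_all uv by simp
  qed
  show ?thesis
  proof (cases "even (z - t0)")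
    case True
    then obtain i where "z - t0 = 2 * i" by (elim evenE)
    then have "z = t0 + 2 * i" by simp
    then show ?thesis using same_parity \<open>t0 \<in> K\<close> by blast
  next
    case False
    then have "even (z - hop m t0)" using \<open>even m\<close> by (simp add: hop_def)
    then obtain i where "z - hop m t0 = 2 * i" by (elim evenE)
    then have "z = hop m t0 + 2 * i" by simp
    then show ?thesis using same_parity hop \<open>t0 \<in> K\<close> by blast
  qed
qed


context rosette
begin

lemma full_turn: "x (t + 4 * m) = x t"
  using half_turn[of t] half_turn[of "t + 2 * m"] by (simp add: algebra_simps)

lemma full_turns: "x (t + 4 * m * i) = x t"
proof (induction i rule: int_induct[of _ 0])
  case (step1 i)
  then show ?case using full_turn[of "t + 4 * m * i"] by (simp add: algebra_simps)
next
  case (step2 i)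
  then show ?case using full_turn[of "t + 4 * m * (i - 1)"] by (simp add: algebra_simps)
qed simp

lemma full_mod: "x (t mod (4 * m) + u) = x (t + u)"
  using full_turns[of "t mod (4 * m) + u" "t div (4 * m)"] mod_mult_div_eq[of t "4 * m"]
  by (simp add: add.commute add.left_commute)

lemma bounds: "0 \<le> x t \<and> x t \<le> w"
proof (rule int_translation_induct[of "2 * m" "\<lambda>t. 0 \<le> x t \<and> x t \<le> w"])
  fix t assume "0 \<le> t" "t < 2 * m"
  then show "0 \<le> x t \<and> x t \<le> w"
    using outer[of t] inner[of t] p_pos p_less by (cases "t < m + a") auto
qed (use m_pos half_turn in auto)

lemma jump_hop: "jump p q (x (hop m t) - x t) (x (hop m t + m) - x (t + m))"
proof (rule int_translation_induct[OF m_pos,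
      of "\<lambda>t. jump p q (x (hop m t) - x t) (x (hop m t + m) - x (t + m))"])
  fix t
  have "x (hop m (t + m) + m) - x (t + m + m) = - (x (hop m t) - x t)"
    "x (hop m (t + m)) - x (t + m) = x (hop m t + m) - x (t + m)"
    unfolding hop_shift[OF m_pos]
    using half_turn[of t] half_turn[of "hop m t"] by (simp_all add: algebra_simps)
  then show "jump p q (x (hop m (t + m)) - x (t + m)) (x (hop m (t + m) + m) - x (t + m + m)) \<longleftrightarrow>
      jump p q (x (hop m t) - x t) (x (hop m t + m) - x (t + m))"
    by (simp only: jump_rotate)
next
  fix t assume t: "0 \<le> t" "t < m"
  have "x (3 * m - 1 - t) = x t + q"
    using half_turn[of "m - 1 - t"] diagonal[of "t + a - m"] fold[OF t] by (simp add: algebra_simps)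
  moreover have "x (4 * m - 1 - t) = x (t + m) + p"
    using full_turn[of "- 1 - t"] diagonal[of "t + a"] climb[of "t + m"] t by (simp add: algebra_simps)
  ultimately show "jump p q (x (hop m t) - x t) (x (hop m t + m) - x (t + m))"
    using t p_pos p_less by (simp add: hop_base jump_def algebra_simps)
qed

lemma jump_hop': "jump p q (x (hop m (t - a) + a) - x t) (x (hop m (t - a) + a + m) - x (t + m))"
proof -
  have "jump p q (x (hop m u + a) - x (u + a)) (x (hop m u + a + m) - x (u + a + m))" for u
  proof (rule int_translation_induct[OF m_pos,
        of "\<lambda>u. jump p q (x (hop m u + a) - x (u + a)) (x (hop m u + a + m) - x (u + a + m))"])
    fix t
    have "x (hop m (t + m) + a + m) - x (t + m + a + m) = - (x (hop m t + a) - x (t + a))"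
      "x (hop m (t + m) + a) - x (t + m + a) = x (hop m t + a + m) - x (t + a + m)"
      unfolding hop_shift[OF m_pos]
      using half_turn[of "t + a"] half_turn[of "hop m t + a"] by (simp_all add: algebra_simps)
    then show "jump p q (x (hop m (t + m) + a) - x (t + m + a))
        (x (hop m (t + m) + a + m) - x (t + m + a + m)) \<longleftrightarrow>
        jump p q (x (hop m t + a) - x (t + a)) (x (hop m t + a + m) - x (t + a + m))"
      by (simp only: jump_rotate)
  next
    fix t assume t: "0 \<le> t" "t < m"
    have "x (3 * m - 1 - t + a) = x (t + a) + q"
      using half_turn[of "m + a - 1 - t"] diagonal[of "t - m"] fold[OF t] by (simp add: algebra_simps)
    moreover have "x (4 * m - 1 - t + a) = x (t + a + m) - p"
      using full_turn[of "a - 1 - t"] diagonal[of t] climb[of "t + m"] t by (simp add: algebra_simps)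
    ultimately show "jump p q (x (hop m t + a) - x (t + a)) (x (hop m t + a + m) - x (t + a + m))"
      using t p_pos p_less by (simp add: hop_base jump_def algebra_simps)
  qed
  from this[of "t - a"] show ?thesis by simp
qed

lemma hops_differ: "\<not> 4 * m dvd hop m t - (hop m (t - a) + a)"
proof
  assume "4 * m dvd hop m t - (hop m (t - a) + a)"
  then have "2 * m dvd hop m t - (hop m (t - a) + a)"
    by (rule dvd_trans[rotated]) (rule mult_dvd_mono, simp_all)
  moreover have "hop m t - (hop m (t - a) + a) = 2 * m * (t div m - (t - a) div m) - 2 * a"
    by (simp add: hop_def algebra_simps)
  ultimately have "2 * m dvd 2 * m * (t div m - (t - a) div m) - (2 * m * (t div m - (t - a) div m) - 2 * a)"
    by (metis dvd_diff dvd_triv_left)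
  then have "m dvd a" by simp
  then show False using zdvd_not_zless a_pos a_less by blast
qed

lemma neighbours:
  assumes "0 \<le> g" "g < p + q - w" "0 \<le> h" "h < p + q - w"
    and "jump p q (X - (x t + g)) (Y - (x (t + m) + h))"
    and "0 \<le> X" "X < p + q" "0 \<le> Y" "Y < p + q"
  shows "\<exists>u. X = x u + g \<and> Y = x (u + m) + h"
proof -
  define nbr where "nbr X' Y' \<longleftrightarrow> jump p q (X' - (x t + g)) (Y' - (x (t + m) + h)) \<and>
      0 \<le> X' \<and> X' < p + q \<and> 0 \<le> Y' \<and> Y' < p + q" for X' Y'
  have in_board: "0 \<le> x u + g \<and> x u + g < p + q" "0 \<le> x u + h \<and> x u + h < p + q" for u
    using bounds[of u] assms(1-4) by linarith+
  obtain b c where bc: "\<And>X' Y'. nbr X' Y' \<Longrightarrow> (X', Y') = b \<or> (X', Y') = c"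
    using at_most_two_neighbours[of p q "x t + g" "x (t + m) + h"] p_pos p_less in_board
    unfolding nbr_def by (metis less_imp_le)
  define u v where "u = hop m t" and "v = hop m (t - a) + a"
  have "nbr (x u + g) (x (u + m) + h)" "nbr (x v + g) (x (v + m) + h)"
    using jump_hop[of t] jump_hop'[of t] in_board by (simp_all add: nbr_def u_def v_def)
  moreover have "nbr X Y" using assms by (simp add: nbr_def)
  moreover have "(x u + g, x (u + m) + h) \<noteq> (x v + g, x (v + m) + h)"
    using injective[of u v] hops_differ[of t] by (auto simp: u_def v_def)
  ultimately have "(X, Y) = (x u + g, x (u + m) + h) \<or> (X, Y) = (x v + g, x (v + m) + h)"
    using bc by metis
  then show ?thesis by blast
qed

text \<open>
  The squares of a translated rosette with both coordinates less than \<open>q\<close> lie on a side, a corner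
  and the next side; they form the corner used in \<open>rosette_ascend_plus\<close>.
\<close>

lemma near_corner_index:
  assumes "x t + g < q" "x (t + m) + h < q" "0 \<le> g" "0 \<le> h"
  obtains u where "- (m - a) \<le> u" "u < m" "x u = x t" "x (u + m) = x (t + m)"
proof -
  define u where "u = (t + (m - a)) mod (4 * m) - (m - a)"
  have same: "x u = x t" "x (u + m) = x (t + m)"
    using full_mod[of "t + (m - a)" "- (m - a)"] full_mod[of "t + (m - a)" "a"]
    by (simp_all add: u_def algebra_simps)
  have u: "- (m - a) \<le> u" "u < 3 * m + a"
    using m_pos pos_mod_bound[of "4 * m" "t + (m - a)"] by (simp_all add: u_def)
  have "u < m"
  proof (rule ccontr)
    assume "\<not> u < m"
    then consider "m \<le> u" "u < 2 * m" | "2 * m \<le> u" by linarith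
    then show False
    proof cases
      case 1
      then show ?thesis
        using half_turn[of "u - m"] outer[of "u - m"] a_pos assms same by (simp add: algebra_simps)
    next
      case 2
      then show ?thesis
        using half_turn[of "u - 2 * m"] outer[of "u - 2 * m"] u assms same by simp
    qed
  qed
  then show ?thesis using that same u by blast
qed

text \<open>
  Likewise for the squares with both coordinates at least \<open>p\<close> and \<open>rosette_ascend_minus\<close>.
\<close>

lemma far_corner_index:
  assumes "p \<le> x t + g" "p \<le> x (t + m) + h" "g < p + q - w" "h < p + q - w"
  obtains u where "m + a \<le> u" "u < 3 * m" "x u = x t" "x (u + m) = x (t + m)"
proof -
  define u where "u = (t - (m + a)) mod (4 * m) + (m + a)"
  have same: "x u = x t" "x (u + m) = x (t + m)"
    using full_mod[of "t - (m + a)" "m + a"] full_mod[of "t - (m + a)" "m + a + m"]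
    by (simp_all add: u_def algebra_simps)
  have u: "m + a \<le> u" "u < 5 * m + a"
    using m_pos pos_mod_bound[of "4 * m" "t - (m + a)"] by (simp_all add: u_def)
  have "u < 3 * m"
  proof (rule ccontr)
    assume "\<not> u < 3 * m"
    then consider "3 * m \<le> u" "u < 4 * m" | "4 * m \<le> u" by linarith
    then show False
    proof cases
      case 1
      then show ?thesis
        using full_turn[of "u - 3 * m"] outer[of "u - 3 * m"] a_pos assms same by (simp add: algebra_simps)
    next
      case 2
      then show ?thesis
        using full_turn[of "u - 4 * m"] outer[of "u - 4 * m"] u assms same by simp
    qed
  qed
  then show ?thesis using that same u by blast
qed

end

section \<open>A rosette through every non-isolated square\<close>

text \<open>
  The square \<open>(X, Y)\<close> lies on a translate of a rosette of the $(p,q)$-leaper that fits into the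
  board \<open>{0..<p + q} \<times> {0..<p + q}\<close>. The proportions \<open>r\<close> and \<open>s\<close> of the second leaper are left open.
\<close>

definition covered :: "int \<Rightarrow> int \<Rightarrow> int \<Rightarrow> int \<Rightarrow> bool" where
  "covered p q X Y \<longleftrightarrow> (\<exists>x a m w r s g h t. rosette x a m p q w r s \<and>
     0 \<le> g \<and> g < p + q - w \<and> 0 \<le> h \<and> h < p + q - w \<and> X = x t + g \<and> Y = x (t + m) + h)"

lemma coveredI:
  assumes "rosette x a m p q w r s" "0 \<le> g" "g < p + q - w" "0 \<le> h" "h < p + q - w"
    and "X = x t + g" "Y = x (t + m) + h"
  shows "covered p q X Y"
  using assms unfolding covered_def by blast

lemma covered_rotate:
  assumes "covered p q X Y"
  shows "covered p q Y (p + q - 1 - X)"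
proof -
  from assms obtain x a m w r s g h t where ros: "rosette x a m p q w r s"
    and gh: "0 \<le> g" "g < p + q - w" "0 \<le> h" "h < p + q - w"
    and XY: "X = x t + g" "Y = x (t + m) + h"
    unfolding covered_def by blast
  interpret rosette x a m p q w r s by (fact ros)
  show ?thesis
    by (rule coveredI[OF ros gh(3,4), of "p + q - 1 - w - g" _ "t + m"])
      (use gh XY half_turn[of t] in \<open>simp_all add: algebra_simps\<close>)
qed

lemma covered_rotate_iff: "covered p q Y (p + q - 1 - X) \<longleftrightarrow> covered p q X Y"
proof
  assume "covered p q Y (p + q - 1 - X)"
  from covered_rotate[OF covered_rotate[OF covered_rotate[OF this]]]
  show "covered p q X Y" by simp
qed (rule covered_rotate)

lemma covered_neighbour:
  assumes "covered p q X Y" "jump p q (X' - X) (Y' - Y)"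
    and "0 \<le> X'" "X' < p + q" "0 \<le> Y'" "Y' < p + q"
  shows "covered p q X' Y'"
proof -
  from assms(1) obtain x a m w r s g h t where ros: "rosette x a m p q w r s"
    and gh: "0 \<le> g" "g < p + q - w" "0 \<le> h" "h < p + q - w"
    and XY: "X = x t + g" "Y = x (t + m) + h"
    unfolding covered_def by blast
  interpret rosette x a m p q w r s by (fact ros)
  obtain u where "X' = x u + g" "Y' = x (u + m) + h"
    using neighbours[OF gh] assms XY by metis
  then show ?thesis using coveredI[OF ros gh] by blast
qed

text \<open>
  Here \<open>2 * j * p\<close> is the even multiple of \<open>p\<close> nearest to \<open>q\<close>. The distance \<open>\<sigma>\<close> cannot be equal to \<open>p\<close>, since
  then \<open>p + q\<close> would be an even multiple of \<open>p\<close>.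
\<close>

lemma even_quotient:
  fixes p q :: int
  assumes "0 < p" "p < q" "odd (p + q)"
  obtains j \<sigma> where "1 \<le> j" "0 \<le> \<sigma>" "\<sigma> < p" "odd (\<sigma> + p)"
    and "q = 2 * j * p + \<sigma> \<or> q = 2 * j * p - \<sigma>"
proof -
  define k \<rho> where "k = q div p" and "\<rho> = q mod p"
  have q: "q = k * p + \<rho>" by (simp add: k_def \<rho>_def)
  have \<rho>: "0 \<le> \<rho>" "\<rho> < p" using assms(1) by (simp_all add: \<rho>_def)
  have k: "1 \<le> k"
    using zdiv_mono1[of p q p] assms by (simp add: k_def)
  show ?thesis
  proof (cases "even k")
    case True
    then obtain j where j: "k = 2 * j" by (elim evenE)
    show ?thesis
      by (rule that[of j \<rho>]) (use j k q \<rho> assms(3) in auto)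
  next
    case False
    then obtain i where i: "k = 2 * i + 1" by (elim oddE)
    have pos: "0 < \<rho>"
    proof (rule ccontr)
      assume "\<not> 0 < \<rho>"
      then have "p + q = 2 * (i + 1) * p" using \<rho>(1) q i by (simp add: algebra_simps)
      then show False using assms(3) by simp
    qed
    have q': "q = 2 * (i + 1) * p - (p - \<rho>)" using q i by (simp add: algebra_simps)
    show ?thesis
    proof (rule that[of "i + 1" "p - \<rho>"])
      show "odd (p - \<rho> + p)"
      proof -
        have *: "p - \<rho> + p = 2 * ((i + 2) * p) - (p + q)" using q' by (simp add: algebra_simps)
        show ?thesis unfolding * using assms(3) by simp
      qed
    qed (use i k pos \<rho> q' in auto)
  qed
qed

text \<open>
  The descent. For \<open>q = 2 * j * p + \<sigma>\<close> the corner of the board is placed on the lower left part of the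
  board of the $(\sigma,p)$-leaper, and for \<open>q = 2 * j * p - \<sigma>\<close> on its upper right part.
\<close>

lemma covered_corner:
  assumes p: "0 < p" "p < q" and "odd (p + q)"
    and smaller: "\<And>\<sigma> X Y. 0 \<le> \<sigma> \<Longrightarrow> \<sigma> < p \<Longrightarrow> odd (\<sigma> + p) \<Longrightarrow>
      0 \<le> X \<Longrightarrow> X < \<sigma> + p \<Longrightarrow> 0 \<le> Y \<Longrightarrow> Y < \<sigma> + p \<Longrightarrow>
      \<not> (\<sigma> \<le> X \<and> X < p \<and> \<sigma> \<le> Y \<and> Y < p) \<Longrightarrow> covered \<sigma> p X Y"
    and XY: "0 \<le> X" "X < p" "0 \<le> Y" "Y < p"
  shows "covered p q X Y"
proof -
  obtain j \<sigma> where j: "1 \<le> j" and \<sigma>: "0 \<le> \<sigma>" "\<sigma> < p" "odd (\<sigma> + p)"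
    and "q = 2 * j * p + \<sigma> \<or> q = 2 * j * p - \<sigma>"
    by (rule even_quotient[OF p \<open>odd (p + q)\<close>])
  then consider (plus) "q = 2 * j * p + \<sigma>" | (minus) "q = 2 * j * p - \<sigma>" by blast
  then show ?thesis
  proof cases
    case plus
    show ?thesis
    proof (cases "\<sigma> \<le> X \<and> \<sigma> \<le> Y")
      case True
      have q: "2 * j * p + 2 * \<sigma> - \<sigma> = q" using plus by simp
      obtain x where x: "rosette x 1 (2 * j) p q (2 * j * p + 2 * \<sigma>) \<sigma> p"
        "x 0 = \<sigma>" "x (2 * j) = \<sigma>"
        using rosette_base[OF j \<sigma>(1,2), of \<sigma>] p(2) by (auto simp only: q)
      show ?thesis
        by (rule coveredI[OF x(1), of "X - \<sigma>" "Y - \<sigma>" _ 0]) (use True XY plus x in auto)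
    next
      case False
      then have "covered \<sigma> p X Y" using smaller[of \<sigma> X Y] \<sigma> XY by auto
      then obtain x a m w r s g h t where ros: "rosette x a m \<sigma> p w r s"
        and gh: "0 \<le> g" "g < \<sigma> + p - w" "0 \<le> h" "h < \<sigma> + p - w"
        and xy: "X = x t + g" "Y = x (t + m) + h"
        unfolding covered_def by blast
      interpret rosette x a m \<sigma> p w r s by (fact ros)
      obtain u where u: "- (m - a) \<le> u" "u < m" "x u = x t" "x (u + m) = x (t + m)"
        using near_corner_index[of t g h] xy XY gh by auto
      obtain x' where x': "rosette x' (2 * m - a) (2 * j * (2 * m - a) + m) p q (2 * j * p + w) r s"
        and x'_eq: "\<And>t. 0 \<le> t \<Longrightarrow> t < 2 * m - a \<Longrightarrow>
          x' t = x (t - (m - a)) \<and> x' (t + (2 * j * (2 * m - a) + m)) = x (t + a)"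
        by (rule rosette_ascend_plus[OF j, folded plus]) (rule that)
      show ?thesis
        by (rule coveredI[OF x', of g h _ "u + (m - a)"])
          (use gh xy u x'_eq[of "u + (m - a)"] plus in \<open>simp_all add: add.commute\<close>)
    qed
  next
    case minus
    show ?thesis
    proof (cases "X < p - \<sigma> \<and> Y < p - \<sigma>")
      case True
      obtain x where x: "rosette x 1 (2 * j) p q (2 * j * p) \<sigma> p" "x 0 = 0" "x (2 * j) = 0"
        using rosette_base[OF j \<sigma>(1,2), of 0] p(2) unfolding minus by auto
      show ?thesis
        by (rule coveredI[OF x(1), of X Y _ 0]) (use True XY minus x in auto)
    next
      case False
      then have "covered \<sigma> p (X + \<sigma>) (Y + \<sigma>)" using smaller[of \<sigma> "X + \<sigma>" "Y + \<sigma>"] \<sigma> XY by auto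
      then obtain x a m w r s g h t where ros: "rosette x a m \<sigma> p w r s"
        and gh: "0 \<le> g" "g < \<sigma> + p - w" "0 \<le> h" "h < \<sigma> + p - w"
        and xy: "X + \<sigma> = x t + g" "Y + \<sigma> = x (t + m) + h"
        unfolding covered_def by blast
      interpret rosette x a m \<sigma> p w r s by (fact ros)
      obtain u where u: "m + a \<le> u" "u < 3 * m" "x u = x t" "x (u + m) = x (t + m)"
        using far_corner_index[of t g h] xy XY gh by auto
      obtain x' where x': "rosette x' (2 * m - a) (2 * j * (2 * m - a) - m) p q (2 * j * p + w - 2 * \<sigma>) r s"
        and x'_eq: "\<And>t. 0 \<le> t \<Longrightarrow> t < 2 * m - a \<Longrightarrow> x' t = w - \<sigma> - x (t + a) \<and>
          x' (t + (2 * j * (2 * m - a) - m)) = w - \<sigma> - x (t - (m - a))"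
        by (rule rosette_ascend_minus[OF j, folded minus]) (rule that)
      \<comment> \<open>The new corner traverses the old indices \<open>{m + a..<3 * m}\<close> backwards.\<close>
      define v where "v = 3 * m - 1 - u"
      have "x (v + a) = w - x u"
        using diagonal[of "u - 3 * m"] half_turn_back[of u] by (simp add: v_def algebra_simps)
      moreover have "x (v - (m - a)) = w - x (u + m)"
        using diagonal[of "u - 2 * m"] half_turn_back[of "u + m"] by (simp add: v_def algebra_simps)
      ultimately have "x' v = x u - \<sigma>" "x' (v + (2 * j * (2 * m - a) - m)) = x (u + m) - \<sigma>"
        using x'_eq[of v] u by (simp_all add: v_def)
      then show ?thesis
        by (intro coveredI[OF x', of g h _ v]) (use gh xy u minus in \<open>simp_all add: add.commute\<close>)
    qed
  qed
qed

text \<open>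
  A square whose first coordinate is less than \<open>p\<close> or at least \<open>q\<close> is joined by moves that lower its
  second coordinate by \<open>p\<close> to a corner square, and corner squares are rotations of one another.
\<close>

lemma covered_board:
  fixes p q X Y :: int
  assumes "0 \<le> p" "p < q" "odd (p + q)"
    and "0 \<le> X" "X < p + q" "0 \<le> Y" "Y < p + q"
    and "\<not> (p \<le> X \<and> X < q \<and> p \<le> Y \<and> Y < q)"
  shows "covered p q X Y"
  using assms
proof (induction "nat p" arbitrary: p q X Y rule: less_induct)
  case less
  have p: "0 < p" using less.prems by linarith
  have corner: "covered p q X Y" if "0 \<le> X" "X < p" "0 \<le> Y" "Y < p" for X Y
    by (rule covered_corner[OF p less.prems(2,3)]) (use that less.hyps less.prems(1) in auto)
  have column: "covered p q X Y"
    if "0 \<le> X" "X < p + q" "X < p \<or> q \<le> X" "0 \<le> Y" "Y < p + q" for X Y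
    using that
  proof (induction "nat Y" arbitrary: X Y rule: less_induct)
    case step: less
    show ?case
    proof (cases "p \<le> Y")
      case True
      define X' where "X' = (if X < p then X + q else X - q)"
      have "covered p q X' (Y - p)"
        using step.prems True p less.prems(2) by (intro step.hyps) (auto simp: X'_def)
      then show ?thesis
        by (rule covered_neighbour)
          (use step.prems less.prems(2) p in \<open>auto simp: jump_def X'_def\<close>)
    next
      case False
      show ?thesis
      proof (cases "X < p")
        case True
        then show ?thesis using corner False step.prems by simp
      next
        case Xbig: False
        have "covered p q Y (p + q - 1 - X)"
          by (rule corner) (use False Xbig step.prems in auto)
        then show ?thesis by (simp only: covered_rotate_iff)
      qed
    qed
  qed
  show ?case
  proof (cases "X < p \<or> q \<le> X")
    case True
    then show ?thesis using column less.prems by simp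
  next
    case False
    then have "covered p q Y (p + q - 1 - X)"
      by (intro column) (use less.prems in auto)
    then show ?thesis by (simp only: covered_rotate_iff)
  qed
qed

section \<open>Hamiltonian cycles of the second leaper\<close>

lemma jump_minus: "jump p q (u - v) (y - z) \<longleftrightarrow> jump p q (v - u) (z - y)"
  by (simp add: jump_def abs_minus_commute)

lemma simple_cycle_neighbours:
  assumes "simple_cycle G C" "z \<in> set C"
  obtains z1 z2 where "z1 \<in> set C" "z2 \<in> set C" "z1 \<noteq> z2" "{z, z1} \<in> snd G" "{z, z2} \<in> snd G"
proof -
  define n where "n = length C"
  have n: "3 \<le> n" and dist: "distinct C"
    and edge: "\<And>i. i < n \<Longrightarrow> {C ! i, C ! (Suc i mod n)} \<in> snd G"
    using assms(1) by (auto simp: simple_cycle_def n_def)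
  obtain i where i: "i < n" "z = C ! i" using assms(2) by (auto simp: in_set_conv_nth n_def)
  define k where "k = (if i = 0 then n - 1 else i - 1)"
  have k: "k < n" "Suc k mod n = i" using i n by (auto simp: k_def)
  have "Suc i mod n \<noteq> k"
    using i n by (auto simp: k_def mod_Suc)
  moreover have "Suc i mod n < n" using n by (intro mod_less_divisor) simp
  ultimately have "C ! (Suc i mod n) \<noteq> C ! k"
    using dist k(1) nth_eq_iff_index_eq[of C "Suc i mod n" k] by (simp add: n_def)
  then show ?thesis
    using that[of "C ! (Suc i mod n)" "C ! k"] edge[OF i(1)] edge[OF k(1)] i k
      \<open>Suc i mod n < n\<close> by (simp add: insert_commute n_def)
qed

lemma simple_cycle_subset:
  assumes "simple_cycle G C" "C ! 0 \<in> S"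
    and "\<And>z z'. z \<in> S \<Longrightarrow> z \<in> set C \<Longrightarrow> z' \<in> set C \<Longrightarrow> {z, z'} \<in> snd G \<Longrightarrow> z' \<in> S"
  shows "set C \<subseteq> S"
proof -
  have "C ! i \<in> S" if "i < length C" for i
    using that
  proof (induction i)
    case (Suc i)
    have "Suc i mod length C = Suc i" using Suc.prems by simp
    moreover have "{C ! i, C ! (Suc i mod length C)} \<in> snd G"
      using assms(1) Suc.prems unfolding simple_cycle_def by (metis Suc_lessD)
    ultimately have "{C ! i, C ! Suc i} \<in> snd G" by simp
    then show ?case using Suc assms(3)[of "C ! i" "C ! Suc i"] by simp
  qed (use assms(2) in simp)
  then show ?thesis by (auto simp: in_set_conv_nth)
qed

lemma chessboard_iff:
  "z \<in> chessboard b n n \<longleftrightarrow> 0 \<le> fst z - fst b \<and> fst z - fst b < int n \<and>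
     0 \<le> snd z - snd b \<and> snd z - snd b < int n"
  by (cases z) (auto simp: chessboard_def)

lemma leaper_edge_iff:
  "{z, z'} \<in> snd (leaper_graph p q B) \<longleftrightarrow>
     z \<in> B \<and> z' \<in> B \<and> jump (int p) (int q) (fst z' - fst z) (snd z' - snd z)"
proof -
  have sym: "jump (int p) (int q) (fst y' - fst y) (snd y' - snd y) \<longleftrightarrow>
      jump (int p) (int q) (fst y - fst y') (snd y - snd y')" for y y' :: square
    by (rule jump_minus)
  show ?thesis
    unfolding leaper_graph_def leaper_move_iff_jump snd_conv mem_Collect_eq doubleton_eq_iff
    using sym by metis
qed

lemma leaper_graph_swap: "leaper_graph p q B = leaper_graph q p B"
  by (simp add: leaper_graph_def leaper_move_iff_jump jump_def disj_commute)

lemma cycle_closed: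
  fixes p q :: nat and b :: square
  defines "G \<equiv> leaper_graph p q (chessboard b (p + q) (p + q))"
  assumes "p < q" "simple_cycle G C" "z \<in> set C" "{z, z'} \<in> snd G"
  shows "z' \<in> set C"
proof -
  obtain z1 z2 where z12: "z1 \<in> set C" "z2 \<in> set C" "z1 \<noteq> z2" "{z, z1} \<in> snd G" "{z, z2} \<in> snd G"
    using simple_cycle_neighbours[OF assms(3,4)] by blast
  define nbr where "nbr X Y \<longleftrightarrow>
      jump (int p) (int q) (X - (fst z - fst b)) (Y - (snd z - snd b)) \<and>
      0 \<le> X \<and> X < int p + int q \<and> 0 \<le> Y \<and> Y < int p + int q" for X Y
  have "z \<in> chessboard b (p + q) (p + q)" using assms(5) by (simp add: G_def leaper_edge_iff)
  then have "\<exists>c d. \<forall>X Y. nbr X Y \<longrightarrow> (X, Y) = c \<or> (X, Y) = d"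
    unfolding nbr_def chessboard_iff using \<open>p < q\<close> by (intro at_most_two_neighbours) simp_all
  then obtain c d where cd: "\<And>X Y. nbr X Y \<Longrightarrow> (X, Y) = c \<or> (X, Y) = d" by blast
  have "nbr (fst y - fst b) (snd y - snd b)" if "{z, y} \<in> snd G" for y
    using that by (simp add: G_def leaper_edge_iff chessboard_iff nbr_def)
  then have "(fst y - fst b, snd y - snd b) \<in> {c, d}" if "{z, y} \<in> snd G" for y
    using cd that by blast
  from this[OF z12(4)] this[OF z12(5)] this[OF assms(5)] z12(3)
  have "z' = z1 \<or> z' = z2" by (auto simp: prod_eq_iff)
  then show ?thesis using z12 by blast
qed

lemma second_leaper:
  fixes p q :: nat and b :: square
  assumes "p < q" "odd (p + q)"
    and cycle: "simple_cycle (leaper_graph p q (chessboard b (p + q) (p + q))) C"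
  shows "\<exists>r s :: nat. leaper r s \<and> {r, s} \<noteq> {p, q} \<and>
           (\<exists>H. hamiltonian_cycle (leaper_graph r s (set C)) H)"
proof -
  define G where "G = leaper_graph p q (chessboard b (p + q) (p + q))"
  note cyc = cycle[folded G_def]
  have "3 \<le> length C" using cyc by (simp add: simple_cycle_def)
  then have start: "C ! 0 \<in> set C" by (intro nth_mem) linarith
  obtain z where z: "{C ! 0, z} \<in> snd G"
    using simple_cycle_neighbours[OF cyc start] by blast
  have "covered (int p) (int q) (fst (C ! 0) - fst b) (snd (C ! 0) - snd b)"
  proof (rule covered_board)
    show "\<not> (int p \<le> fst (C ! 0) - fst b \<and> fst (C ! 0) - fst b < int q \<and>
        int p \<le> snd (C ! 0) - snd b \<and> snd (C ! 0) - snd b < int q)"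
      using z unfolding G_def leaper_edge_iff chessboard_iff jump_def by auto
  qed (use z assms(1,2) in \<open>simp_all add: G_def leaper_edge_iff chessboard_iff\<close>)
  then obtain x a m w r s g h t where ros: "rosette x a m (int p) (int q) w r s"
    and gh: "0 \<le> g" "g < int p + int q - w" "0 \<le> h" "h < int p + int q - w"
    and t: "fst (C ! 0) - fst b = x t + g" "snd (C ! 0) - snd b = x (t + m) + h"
    unfolding covered_def by blast
  interpret rosette x a m "int p" "int q" w r s by (fact ros)
  define f where "f u = (x u + g + fst b, x (u + m) + h + snd b)" for u
  have f_board: "f u \<in> chessboard b (p + q) (p + q)" for u
    using bounds[of u] bounds[of "u + m"] gh by (simp add: f_def chessboard_iff)
  have f_period: "f (u + 4 * m) = f u" for u
    using full_turn[of u] full_turn[of "u + m"] by (simp add: f_def algebra_simps)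
  have f_start: "C ! 0 = f t" using t by (simp add: f_def prod_eq_iff)
  have "set C \<subseteq> range f"
  proof (rule simple_cycle_subset[OF cyc])
    fix y y' assume "y \<in> range f" "{y, y'} \<in> snd G"
    then obtain u where u: "jump (int p) (int q) (fst y' - fst b - (x u + g)) (snd y' - snd b - (x (u + m) + h))"
      and y': "y' \<in> chessboard b (p + q) (p + q)"
      by (auto simp: G_def leaper_edge_iff f_def algebra_simps)
    obtain v where "fst y' - fst b = x v + g" "snd y' - snd b = x (v + m) + h"
      using neighbours[OF gh u] y' by (auto simp: chessboard_iff)
    then have "y' = f v" by (simp add: f_def prod_eq_iff)
    then show "y' \<in> range f" by blast
  qed (use f_start in simp)
  moreover have "f u \<in> set C" for u
  proof -
    have edge: "{f u, f v} \<in> snd G" if "jump (int p) (int q) (x v - x u) (x (v + m) - x (u + m))" for u v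
      using that f_board by (simp add: G_def leaper_edge_iff) (simp add: f_def)
    have "u \<in> {u. f u \<in> set C}"
    proof (rule hop_orbit_full[OF m_pos odd_a even_m coprime_am])
      show "hop m v \<in> {u. f u \<in> set C}" if "v \<in> {u. f u \<in> set C}" for v
        using that cycle_closed[OF assms(1) cycle] edge[OF jump_hop] by (auto simp: G_def)
      show "hop m (v - a) + a \<in> {u. f u \<in> set C}" if "v \<in> {u. f u \<in> set C}" for v
        using that cycle_closed[OF assms(1) cycle] edge[OF jump_hop'] by (auto simp: G_def)
      show "t \<in> {u. f u \<in> set C}" using start f_start by simp
    qed (simp add: f_period)
    then show ?thesis by simp
  qed
  ultimately have C_eq: "set C = range f" by blast
  define n where "n = nat (4 * m)"
  define H where "H = map (\<lambda>i. f (int i)) [0..<n]"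
  have n: "int n = 4 * m" "4 \<le> n" using m_pos by (simp_all add: n_def)
  have f_mod: "f (u mod (4 * m)) = f u" for u
    using full_mod[of u 0] full_mod[of u m] by (simp add: f_def)
  have set_H: "set H = set C"
  proof -
    have "f u \<in> set H" for u
    proof -
      define i where "i = nat (u mod (4 * m))"
      have "i < n" using n m_pos by (simp add: i_def nat_less_iff)
      moreover have "f u = f (int i)" using m_pos by (simp add: i_def f_mod)
      ultimately show ?thesis unfolding H_def set_map set_upt by (intro image_eqI) auto
    qed
    then show ?thesis unfolding C_eq by (auto simp: H_def)
  qed
  have "distinct H"
  proof -
    have "i = j" if "i < n" "j < n" "f (int i) = f (int j)" for i j
    proof -
      have "4 * m dvd int i - int j"
        using that(3) injective[of "int i" "int j"] by (simp add: f_def)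
      then have "int i mod int n = int j mod int n" using n by (simp add: mod_eq_dvd_iff)
      then show ?thesis using that by simp
    qed
    then show ?thesis by (auto simp: H_def distinct_map inj_on_def)
  qed
  moreover have "{H ! i, H ! (Suc i mod length H)} \<in> snd (leaper_graph (nat r) (nat s) (set C))"
    if "i < length H" for i
  proof -
    have i: "i < n" using that by (simp add: H_def)
    have "H ! (Suc i mod length H) = f (int (Suc i mod n))" using n by (simp add: H_def)
    also have "\<dots> = f (int i + 1)" using f_mod[of "int i + 1"] n by (simp add: zmod_int add.commute)
    finally have "H ! i = f (int i)" "H ! (Suc i mod length H) = f (int i + 1)"
      using i by (simp_all add: H_def)
    then show ?thesis
      using step[of "int i"] r_nonneg s_pos by (simp add: leaper_edge_iff C_eq) (simp add: f_def)
  qed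
  ultimately have "hamiltonian_cycle (leaper_graph (nat r) (nat s) (set C)) H"
    using n set_H unfolding hamiltonian_cycle_def simple_cycle_def
    by (simp add: H_def leaper_graph_def)
  moreover have "leaper (nat r) (nat s)" using s_pos by (simp add: leaper_def)
  moreover have "{nat r, nat s} \<noteq> {p, q}"
    using r_nonneg r_le s_pos s_le p_less by (auto simp: doubleton_eq_iff)
  ultimately show ?thesis by blast
qed

theorem theorem1:
  fixes p q :: nat and a :: square and C :: "square list"
  assumes "leaper p q"
    and "odd (p + q)"
    and "simple_cycle (leaper_graph p q (chessboard a (p + q) (p + q))) C"
  shows "\<exists>r s :: nat. leaper r s \<and> {r, s} \<noteq> {p, q} \<and>
           (\<exists>H. hamiltonian_cycle (leaper_graph r s (set C)) H)"
proof (cases "p < q")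
  case True
  then show ?thesis using second_leaper assms(2,3) by blast
next
  case False
  then have "q < p" using assms(2) by (cases "p = q") auto
  moreover have "simple_cycle (leaper_graph q p (chessboard a (q + p) (q + p))) C"
    using assms(3) by (simp only: leaper_graph_swap add.commute)
  ultimately show ?thesis
    using second_leaper[of q p a C] assms(2) by (simp add: add.commute insert_commute)
qed

end
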